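(* Let $\mathcal{X}$ be a nonempty Polish space, $\mathcal{Y}=\mathbb{R}^d$, $p\ge 1$, $\nu\in\mathcal{P}_p(\mathcal{Y})$, and let $\rho:\mathcal{X}\to\mathcal{P}(\mathcal{Y})$, $x\mapsto\rho_x$, be a Markov kernel. Suppose that (CTY) $x\mapsto\rho_x$ is continuous from $\mathcal{X}$ to $\mathcal{P}(\mathcal{Y})$ with the narrow topology, and (CRC) the function $x\mapsto M_p(\rho_x)\in[0,\infty]$ has totally bounded sublevel sets, i.e. for every $c\in\mathbb{R}$ the set $\{x\in\mathcal{X}: M_p(\rho_x)\le c\}$ is totally bounded. Then there exists a minimizer of the problem $\min_{\sigma\in\mathcal{P}(\mathcal{X})}W_p^p(\nu_\sigma,\nu)$, i.e. there is $\sigma_*\in\mathcal{P}(\mathcal{X})$ with $W_p^p(\nu_{\sigma_*},\nu)=\inf_{\sigma\in\mathcal{P}(\mathcal{X})}W_p^p(\nu_\sigma,\nu)$.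
   Context: $\mathcal{X}$ is equipped with a fixed complete metric inducing its (Polish) topology; total boundedness refers to this metric. $\mathcal{P}(\cdot)$ denotes Borel probability measures. $M_p(\mu)=\int|y|^p\,d\mu(y)\in[0,\infty]$ and $\mathcal{P}_p(\mathcal{Y})=\{\mu\in\mathcal{P}(\mathcal{Y}):M_p(\mu)<\infty\}$. A Markov kernel $\rho:\mathcal{X}\to\mathcal{P}(\mathcal{Y})$ is a map such that $x\mapsto\rho_x(B)$ is Borel measurable for every Borel set $B\subseteq\mathcal{Y}$. For $\sigma\in\mathcal{P}(\mathcal{X})$, $\nu_\sigma\in\mathcal{P}(\mathcal{Y})$ is defined by $\int f\,d\nu_\sigma=\int_{\mathcal{X}}\left(\int_{\mathcal{Y}}f(y)\,d\rho_x(y)\right)d\sigma(x)$ for all $f\in C_b(\mathcal{Y})$. $W_p^p(\mu_1,\mu_2)=\inf_{\Gamma}\int|y'-y|^p\,d\Gamma(y',y)\in[0,\infty]$, the infimum over couplings $\Gamma$ of $\mu_1,\mu_2$. The narrow topology is that of convergence against bounded continuous functions. A minimizer is any $\sigma_*$ attaining the infimum, even when the infimum equals $+\infty$. *)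

theory Defs
  imports "HOL-Probability.Probability"
begin

abbreviation borel_probs :: "'a::topological_space measure set" where
  "borel_probs \<equiv> space (prob_algebra borel)"

lemma borel_probs_iff: "\<mu> \<in> borel_probs \<longleftrightarrow> prob_space \<mu> \<and> sets \<mu> = sets borel"
  by (auto simp: space_prob_algebra)

definition bounded_continuous :: "('a::topological_space \<Rightarrow> real) set" where
  "bounded_continuous = {f. continuous_on UNIV f \<and> bounded (range f)}"

definition markov_kernel ::
    "('a::topological_space \<Rightarrow> 'b::topological_space measure) \<Rightarrow> bool" where
  "markov_kernel \<rho> \<longleftrightarrow>
     (\<forall>x. \<rho> x \<in> borel_probs) \<and> (\<forall>B \<in> sets borel. (\<lambda>x. measure (\<rho> x) B) \<in> borel_measurable borel)"

text \<open>The initial topology of the maps \<open>\<mu> \<mapsto> \<integral>f d\<mu>\<close> for bounded continuous \<open>f\<close>.\<close>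

definition narrow_topology :: "'a::topological_space measure topology" where
  "narrow_topology = topology_generated_by
     {{\<mu> \<in> borel_probs. (\<integral>y. f y \<partial>\<mu>) \<in> U} | f U. f \<in> bounded_continuous \<and> open U}"

text \<open>
  \<open>mixture \<rho> \<sigma>\<close> is \<open>\<nu>\<^sub>\<sigma>\<close>. By \<open>mixture_iff\<close> below it is the unique Borel probability measure
  satisfying the defining identity against bounded continuous functions.
\<close>

definition mixture :: "('a \<Rightarrow> 'b measure) \<Rightarrow> 'a measure \<Rightarrow> 'b measure" where
  "mixture \<rho> \<sigma> = Giry_Monad.bind \<sigma> \<rho>"

definition moment :: "real \<Rightarrow> 'a::real_normed_vector measure \<Rightarrow> ennreal" where
  "moment p \<mu> = (\<integral>\<^sup>+ y. ennreal (norm y powr p) \<partial>\<mu>)"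

definition finite_moment_probs :: "real \<Rightarrow> 'a::real_normed_vector measure set" where
  "finite_moment_probs p = {\<mu> \<in> borel_probs. moment p \<mu> < \<infinity>}"

definition couplings ::
    "'a::topological_space measure \<Rightarrow> 'b::topological_space measure \<Rightarrow> ('a \<times> 'b) measure set" where
  "couplings \<mu>\<^sub>1 \<mu>\<^sub>2 =
     {\<Gamma> \<in> borel_probs. distr \<Gamma> borel fst = \<mu>\<^sub>1 \<and> distr \<Gamma> borel snd = \<mu>\<^sub>2}"

text \<open>The \<open>p\<close>-th power of the Wasserstein distance, with values in \<open>[0,\<infinity>]\<close>.\<close>

definition wasserstein_pow ::
    "real \<Rightarrow> 'a::real_normed_vector measure \<Rightarrow> 'a measure \<Rightarrow> ennreal" where
  "wasserstein_pow p \<mu>\<^sub>1 \<mu>\<^sub>2 =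
     (INF \<Gamma> \<in> couplings \<mu>\<^sub>1 \<mu>\<^sub>2. \<integral>\<^sup>+ z. ennreal (norm (fst z - snd z) powr p) \<partial>\<Gamma>)"

lemma markov_kernel_iff_measurable: "markov_kernel \<rho> \<longleftrightarrow> \<rho> \<in> borel \<rightarrow>\<^sub>M prob_algebra borel"
proof
  assume K: "markov_kernel \<rho>"
  show "\<rho> \<in> borel \<rightarrow>\<^sub>M prob_algebra borel"
  proof (rule measurable_prob_algebraI)
    show "prob_space (\<rho> x)" for x
      using K by (simp add: markov_kernel_def borel_probs_iff)
    show "\<rho> \<in> borel \<rightarrow>\<^sub>M subprob_algebra borel"
    proof (rule measurable_subprob_algebra)
      show "subprob_space (\<rho> a)" "sets (\<rho> a) = sets borel" for a
        using K by (auto simp: markov_kernel_def borel_probs_iff prob_space_imp_subprob_space)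
    next
      fix B :: "'b set" assume B: "B \<in> sets borel"
      have "emeasure (\<rho> x) B = ennreal (measure (\<rho> x) B)" for x
        using K by (simp add: markov_kernel_def borel_probs_iff
          finite_measure.emeasure_eq_measure prob_space.finite_measure)
      moreover have "(\<lambda>x. measure (\<rho> x) B) \<in> borel_measurable borel"
        using K B by (auto simp: markov_kernel_def)
      ultimately show "(\<lambda>a. emeasure (\<rho> a) B) \<in> borel_measurable borel" by simp
    qed
  qed
next
  assume M: "\<rho> \<in> borel \<rightarrow>\<^sub>M prob_algebra borel"
  then have "\<rho> \<in> borel \<rightarrow>\<^sub>M subprob_algebra borel"
    by (rule measurable_prob_algebraD)
  then have "(\<lambda>x. measure (\<rho> x) B) \<in> borel_measurable borel" if "B \<in> sets borel" for B
    using measurable_compose[OF _ measurable_measure_subprob_algebra[OF that]] by blast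
  then show "markov_kernel \<rho>"
    using measurable_space[OF M] by (auto simp: markov_kernel_def)
qed

lemma continuous_map_narrow_topology_iff:
  "continuous_map X narrow_topology g \<longleftrightarrow>
    g ` topspace X \<subseteq> borel_probs \<and>
    (\<forall>f \<in> bounded_continuous. continuous_map X euclideanreal (\<lambda>x. \<integral>y. f y \<partial>g x))"
    (is "?L \<longleftrightarrow> ?R")
proof -
  let ?S = "{{\<mu> \<in> borel_probs. (\<integral>y. f y \<partial>\<mu>) \<in> U} | f U.
    f \<in> (bounded_continuous :: ('b \<Rightarrow> real) set) \<and> open U}"
  have "(\<lambda>_. 0) \<in> (bounded_continuous :: ('b \<Rightarrow> real) set)"
    by (simp add: bounded_continuous_def)
  then have "borel_probs \<in> ?S"
    by (intro CollectI exI[of _ "\<lambda>_. 0"] exI[of _ UNIV]) auto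
  then have top: "\<Union>?S = borel_probs" by blast
  have pre: "g -` {\<mu> \<in> borel_probs. (\<integral>y. f y \<partial>\<mu>) \<in> U} \<inter> topspace X
      = {x \<in> topspace X. (\<integral>y. f y \<partial>g x) \<in> U}"
    if "g ` topspace X \<subseteq> borel_probs" for f U
    using that by auto
  have "?L \<longleftrightarrow> (\<forall>U. U \<in> ?S \<longrightarrow> openin X (g -` U \<inter> topspace X)) \<and> g ` topspace X \<subseteq> borel_probs"
    unfolding narrow_topology_def continuous_on_generated_topo_iff top ..
  also have "\<dots> \<longleftrightarrow> g ` topspace X \<subseteq> borel_probs \<and>
      (\<forall>f \<in> bounded_continuous. \<forall>U. open U \<longrightarrow>
        openin X (g -` {\<mu> \<in> borel_probs. (\<integral>y. f y \<partial>\<mu>) \<in> U} \<inter> topspace X))"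
    by blast
  also have "\<dots> \<longleftrightarrow> ?R"
    by (simp add: pre continuous_map_def del: vimage_Collect_eq cong: conj_cong)
  finally show ?thesis .
qed

lemma measure_eqI_bounded_continuous:
  fixes \<mu> \<nu> :: "'a::metric_space measure"
  assumes \<mu>: "\<mu> \<in> borel_probs" and \<nu>: "\<nu> \<in> borel_probs"
    and eq: "\<And>f. f \<in> bounded_continuous \<Longrightarrow> (\<integral>y. f y \<partial>\<mu>) = (\<integral>y. f y \<partial>\<nu>)"
  shows "\<mu> = \<nu>"
proof -
  have closed_eq: "emeasure \<mu> F = emeasure \<nu> F" if F: "closed F" "F \<noteq> {}" for F
  proof -
    define f where "f n x = max 0 (1 - real n * infdist x F)" for n x
    have f_bc: "f n \<in> bounded_continuous" for n
    proof -
      have "continuous_on UNIV (f n)"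
        unfolding f_def by (intro continuous_intros)
      moreover have "norm (f n x) \<le> 1" for x
        using infdist_nonneg[of x F] by (auto simp: f_def)
      ultimately show ?thesis
        by (auto simp: bounded_continuous_def bounded_iff intro!: exI[of _ 1])
    qed
    have lim: "(\<lambda>n. f n x) \<longlonglongrightarrow> indicator F x" for x
    proof (cases "x \<in> F")
      case True
      then show ?thesis by (simp add: f_def)
    next
      case False
      then have pos: "infdist x F > 0"
        using F by (simp add: infdist_pos_not_in_closed)
      obtain N where N: "1 < real N * infdist x F"
        using reals_Archimedean3[OF pos] by blast
      have "f n x = 0" if "n \<ge> N" for n
      proof -
        have "real N * infdist x F \<le> real n * infdist x F"
          using that pos by (intro mult_right_mono) auto
        then show ?thesis using N by (simp add: f_def)
      qed
      then have "eventually (\<lambda>n. f n x = 0) sequentially"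
        unfolding eventually_sequentially by blast
      then show ?thesis
        using False by (simp add: tendsto_eventually)
    qed
    have conv: "(\<lambda>n. \<integral>x. f n x \<partial>M) \<longlonglongrightarrow> measure M F" if M: "M \<in> borel_probs" for M
    proof -
      interpret prob_space M using M by (simp add: borel_probs_iff)
      have [measurable_cong]: "sets M = sets borel" using M by (simp add: borel_probs_iff)
      have Fb[measurable]: "F \<in> sets M" using F \<open>sets M = sets borel\<close> by simp
      have "(\<lambda>n. \<integral>x. f n x \<partial>M) \<longlonglongrightarrow> (\<integral>x. indicator F x \<partial>M)"
      proof (rule integral_dominated_convergence[where w = "\<lambda>_. 1"])
        show "f n \<in> borel_measurable M" for n
          using f_bc[of n] borel_measurable_continuous_onI[of "f n"]
            measurable_cong_sets[OF \<open>sets M = sets borel\<close> refl]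
          by (auto simp: bounded_continuous_def)
        show "AE x in M. norm (f n x) \<le> 1" for n
          using infdist_nonneg[of _ F] by (intro AE_I2) (auto simp: f_def)
      qed (use lim in auto)
      then show ?thesis
        using Fb by simp
    qed
    have "measure \<mu> F = measure \<nu> F"
      using conv[OF \<mu>] conv[OF \<nu>] eq[OF f_bc] LIMSEQ_unique by auto
    then show ?thesis
      using \<mu> \<nu> by (simp add: borel_probs_iff finite_measure.emeasure_eq_measure prob_space.finite_measure)
  qed
  show ?thesis
  proof (rule measure_eqI_generator_eq[where E = "Collect closed" and \<Omega> = UNIV and A = "\<lambda>_. UNIV"])
    show "Int_stable (Collect closed :: 'a set set)"
      by (auto simp: Int_stable_def)
    show "emeasure \<mu> X = emeasure \<nu> X" if "X \<in> Collect closed" for X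
      using that closed_eq by (cases "X = {}") auto
    have "sets borel = sigma_sets UNIV (Collect closed :: 'a set set)"
      unfolding borel_eq_closed by simp
    then show "sets \<mu> = sigma_sets UNIV (Collect closed)" "sets \<nu> = sigma_sets UNIV (Collect closed)"
      using \<mu> \<nu> by (auto simp: borel_probs_iff)
    show "emeasure \<mu> UNIV \<noteq> \<infinity>" for i :: nat
      using \<mu> by (simp add: borel_probs_iff finite_measure.emeasure_eq_measure prob_space.finite_measure)
  qed auto
qed

lemma mixture_iff:
  fixes \<rho> :: "'a::topological_space \<Rightarrow> 'b::metric_space measure"
  assumes \<rho>: "markov_kernel \<rho>" and \<sigma>: "\<sigma> \<in> borel_probs"
  shows "\<mu> = mixture \<rho> \<sigma> \<longleftrightarrow>
    \<mu> \<in> borel_probs \<and>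
    (\<forall>f \<in> bounded_continuous. (\<integral>y. f y \<partial>\<mu>) = (\<integral>x. (\<integral>y. f y \<partial>\<rho> x) \<partial>\<sigma>))"
proof -
  interpret \<sigma>: prob_space \<sigma> using \<sigma> by (simp add: borel_probs_iff)
  have s: "sets \<sigma> = sets borel" using \<sigma> by (simp add: borel_probs_iff)
  have K: "\<rho> \<in> borel \<rightarrow>\<^sub>M prob_algebra borel" using \<rho> by (simp add: markov_kernel_iff_measurable)
  have P: "mixture \<rho> \<sigma> \<in> borel_probs"
    unfolding mixture_def borel_probs_iff
    using prob_space_bind'[OF \<sigma> K] sets_bind'[OF \<sigma> K] by simp
  have K': "\<rho> \<in> \<sigma> \<rightarrow>\<^sub>M subprob_algebra borel"
    using measurable_prob_algebraD[OF K] measurable_cong_sets[OF s refl] by blast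
  have I: "(\<integral>y. f y \<partial>mixture \<rho> \<sigma>) = (\<integral>x. (\<integral>y. f y \<partial>\<rho> x) \<partial>\<sigma>)"
    if f: "f \<in> bounded_continuous" for f
  proof -
    obtain C where C: "\<And>x. \<bar>f x\<bar> \<le> C"
      using f by (auto simp: bounded_continuous_def bounded_iff)
    have fm: "f \<in> borel_measurable borel"
      using f by (auto simp: bounded_continuous_def intro: borel_measurable_continuous_onI)
    show ?thesis
      unfolding mixture_def
    proof (rule integral_bind[where K = borel and B = C and B' = 1])
      show "AE x in \<sigma>. emeasure (\<rho> x) (space (\<rho> x)) \<le> ennreal 1"
        using \<rho> by (intro AE_I2) (simp add: markov_kernel_def borel_probs_iff prob_space.emeasure_space_1)
    qed (use C fm K' \<sigma>.finite_measure_axioms \<sigma>.not_empty in auto)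
  qed
  show ?thesis
  proof
    assume "\<mu> = mixture \<rho> \<sigma>"
    then show "\<mu> \<in> borel_probs \<and>
        (\<forall>f \<in> bounded_continuous. (\<integral>y. f y \<partial>\<mu>) = (\<integral>x. (\<integral>y. f y \<partial>\<rho> x) \<partial>\<sigma>))"
      using P I by simp
  next
    assume "\<mu> \<in> borel_probs \<and>
        (\<forall>f \<in> bounded_continuous. (\<integral>y. f y \<partial>\<mu>) = (\<integral>x. (\<integral>y. f y \<partial>\<rho> x) \<partial>\<sigma>))"
    then show "\<mu> = mixture \<rho> \<sigma>"
      using P I by (intro measure_eqI_bounded_continuous) auto
  qed
qed

end

theory Submission
  imports Defs
begin

text \<open>
  Direct method. Along a minimizing sequence with near-optimal couplings \<open>\<Gamma>\<^sub>n\<close> of \<open>\<nu>\<^bsub>\<sigma>\<^sub>n\<^esub>\<close> and \<open>\<nu>\<close>,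
  the moments \<open>\<integral>M\<^sub>p(\<rho>\<^sub>x) d\<sigma>\<^sub>n(x) = M\<^sub>p(\<nu>\<^bsub>\<sigma>\<^sub>n\<^esub>)\<close> stay bounded. The sublevel sets of \<open>M\<^sub>p \<circ> \<rho>\<close> are
  closed by lower semicontinuity, hence compact, so \<open>(\<sigma>\<^sub>n)\<close> and \<open>(\<Gamma>\<^sub>n)\<close> are tight. By Prokhorov they
  converge narrowly along a subsequence; the limit of the couplings has the right marginals, and its
  cost is at most the infimum.

  Prokhorov's theorem is reduced to Helly's selection theorem on the real line: a \<open>\<sigma>\<close>-compact set
  \<open>S = \<Union>\<^sub>m K\<^sub>m\<close> has a Borel injection \<open>s\<close> into the reals whose inverse extends to a continuous map on the
  closure of \<open>s(S)\<close>. Tietze's theorem turns test functions on \<open>S\<close> into test functions on the reals.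
\<close>

section \<open>Coding a \<open>\<sigma>\<close>-compact set by real numbers\<close>

text \<open>At the first index \<open>j\<close> where the digits differ, the terms differ by
  \<open>(1/3)^j\<close>, and all later terms together can undo at most \<open>(1/3)^j / 2\<close>;
  since \<open>j \<le> i\<close>, the bound at \<open>i\<close> follows. Base 3 matters: in base 2
  the tail could cancel the leading difference completely.\<close>

lemma ternary_digits_separated:
  fixes d e :: "nat \<Rightarrow> real"
  assumes d: "\<And>k. d k \<in> {0, 1}" and e: "\<And>k. e k \<in> {0, 1}" and neq: "d i \<noteq> e i"
  shows "(1/3)^i / 2 \<le> \<bar>(\<Sum>k. d k * (1/3)^k) - (\<Sum>k. e k * (1/3)^k)\<bar>"
proof -
  define j where "j = (LEAST k. d k \<noteq> e k)"
  have j: "d j \<noteq> e j" "j \<le> i" "\<And>k. k < j \<Longrightarrow> d k = e k"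
    using neq LeastI[of "\<lambda>k. d k \<noteq> e k" i] unfolding j_def
    by (auto intro: Least_le dest: not_less_Least)
  define a where "a k = (d k - e k) * (1/3)^k" for k
  have a_le: "norm (a k) \<le> (1/3)^k" for k
    using d[of k] e[of k] by (auto simp: a_def abs_mult)
  have dig: "summable (\<lambda>k. c k * (1/3::real)^k)" if "\<And>k. c k \<in> {0, 1::real}" for c
  proof (rule summable_comparison_test)
    show "\<exists>N. \<forall>n\<ge>N. norm (c n * (1/3)^n) \<le> (1/3::real)^n"
    proof (intro exI allI impI)
      show "norm (c n * (1/3)^n) \<le> (1/3::real)^n" for n
        using that[of n] by auto
    qed
  qed (auto intro: summable_geometric)
  have sd: "summable (\<lambda>k. d k * (1/3)^k)" and se: "summable (\<lambda>k. e k * (1/3)^k)"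
    by (rule dig, rule d) (rule dig, rule e)
  have a_eq: "a = (\<lambda>k. d k * (1/3)^k - e k * (1/3)^k)"
    by (simp add: a_def left_diff_distrib fun_eq_iff)
  have sm: "summable a"
    unfolding a_eq using sd se by (rule summable_diff)
  have diff: "(\<Sum>k. d k * (1/3)^k) - (\<Sum>k. e k * (1/3)^k) = (\<Sum>k. a k)"
    using suminf_diff[OF sd se] by (simp add: a_eq)
  have "(\<Sum>k<Suc j. a k) = a j"
    using j(3) by (simp add: a_def)
  then have split: "(\<Sum>k. a k) = (\<Sum>k. a (k + Suc j)) + a j"
    using suminf_split_initial_segment[OF sm, of "Suc j"] by simp
  have "norm (\<Sum>k. a (k + Suc j)) \<le> (\<Sum>k. (1/3)^(Suc j) * (1/3)^k)"
  proof (rule norm_suminf_le)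
    show "norm (a (k + Suc j)) \<le> (1/3)^(Suc j) * (1/3)^k" for k
      using a_le[of "k + Suc j"] by (simp add: power_add mult.commute)
  qed (intro summable_mult summable_geometric, simp)
  also have "\<dots> = (1/3)^j / 2"
    by (subst suminf_mult) (auto simp: suminf_geometric intro: summable_geometric)
  finally have tail: "\<bar>\<Sum>k. a (k + Suc j)\<bar> \<le> (1/3)^j / 2" by simp
  have "\<bar>a j\<bar> = (1/3)^j"
    using d[of j] e[of j] j(1) by (auto simp: a_def)
  then have "(1/3)^j / 2 \<le> \<bar>\<Sum>k. a k\<bar>"
    using tail split by linarith
  moreover have "(1/3::real)^i \<le> (1/3)^j"
    using j(2) by (intro power_decreasing) auto
  ultimately show ?thesis
    unfolding diff by linarith
qed

text \<open>The \<open>k\<close>-th ternary digit of the code records membership in the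
  \<open>k\<close>-th set of a countable basis. A basic set around \<open>x\<close> that misses a
  neighbourhood \<open>V\<close> of \<open>y\<close> fixes one digit differently on the two sides,
  which keeps the codes uniformly apart. The code may be discontinuous; this local separation is
  what makes its inverse continuous later.\<close>

lemma ex_locally_separating_code:
  "\<exists>s :: 'a::{metric_space, second_countable_topology} \<Rightarrow> real.
     s \<in> borel_measurable borel \<and> (\<forall>x. 0 \<le> s x \<and> s x \<le> 2) \<and>
     (\<forall>x y. x \<noteq> y \<longrightarrow> (\<exists>U V e. open U \<and> open V \<and> x \<in> U \<and> y \<in> V \<and> 0 < e \<and>
        (\<forall>u\<in>U. \<forall>v\<in>V. e \<le> \<bar>s u - s v\<bar>)))"
proof -
  obtain \<B> :: "'a set set" where \<B>: "countable \<B>" "topological_basis \<B>"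
    using ex_countable_basis by blast
  have "\<B> \<noteq> {}"
    using topological_basisE[OF \<B>(2) open_UNIV UNIV_I] by blast
  define B where "B = from_nat_into \<B>"
  have rB: "range B = \<B>"
    unfolding B_def using \<open>\<B> \<noteq> {}\<close> \<B>(1) by (rule range_from_nat_into)
  have oB: "open (B k)" for k
    using \<B>(2) rB by (metis rangeI topological_basis_open)
  define s where "s x = (\<Sum>k. indicator (B k) x * (1/3::real)^k)" for x
  have geo: "summable (\<lambda>k. (1/3::real)^k)"
    by (rule summable_geometric) simp
  have sm: "summable (\<lambda>k. indicator (B k) x * (1/3::real)^k)" for x
    by (rule summable_comparison_test[OF _ geo]) (auto simp: abs_mult indicator_def)
  have [measurable]: "B k \<in> sets borel" for k
    using oB by simp
  have "s \<in> borel_measurable borel"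
    unfolding s_def by measurable
  moreover have "0 \<le> s x \<and> s x \<le> 2" for x
  proof
    show "0 \<le> s x"
      unfolding s_def by (rule suminf_nonneg[OF sm]) simp
    have "s x \<le> (\<Sum>k. (1/3)^k)"
      unfolding s_def by (rule suminf_le[OF _ sm geo]) (simp add: indicator_def)
    then show "s x \<le> 2"
      by (simp add: suminf_geometric)
  qed
  moreover have "\<exists>U V e. open U \<and> open V \<and> x \<in> U \<and> y \<in> V \<and> 0 < e \<and>
      (\<forall>u\<in>U. \<forall>v\<in>V. e \<le> \<bar>s u - s v\<bar>)" if "x \<noteq> y" for x y
  proof -
    obtain U V where UV: "open U" "open V" "x \<in> U" "y \<in> V" "U \<inter> V = {}"
      using hausdorff[OF \<open>x \<noteq> y\<close>] by blast
    obtain B' where "B' \<in> \<B>" "x \<in> B'" "B' \<subseteq> U"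
      using topological_basisE[OF \<B>(2) UV(1,3)] .
    then obtain i where i: "x \<in> B i" "B i \<subseteq> U"
      using rB by blast
    have "(1/3)^i / 2 \<le> \<bar>s u - s v\<bar>" if "u \<in> B i" "v \<in> V" for u v
      unfolding s_def
    proof (rule ternary_digits_separated)
      show "indicator (B i) u \<noteq> (indicator (B i) v :: real)"
        using that i(2) UV(5) by (auto simp: indicator_def)
    qed (auto simp: indicator_def)
    then show ?thesis
      using i oB UV by (intro exI[of _ "B i"] exI[of _ V] exI[of _ "(1/3)^i / 2"]) auto
  qed
  ultimately show ?thesis by blast
qed

text \<open>Used in the coding lemma to pass from a sequence in a closure to nearby points of the
  set, and back.\<close>

lemma tendsto_of_dist_less_inverse_Suc:
  fixes a b :: "nat \<Rightarrow> 'a::metric_space"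
  assumes a: "a \<longlonglongrightarrow> l" and dist_lt: "\<And>n. dist (b n) (a n) < inverse (real (Suc n))"
  shows "b \<longlonglongrightarrow> l"
proof -
  have "(\<lambda>n. dist (a n) l) \<longlonglongrightarrow> 0"
    using a by (simp only: tendsto_dist_iff[symmetric])
  then have lim: "(\<lambda>n. inverse (real (Suc n)) + dist (a n) l) \<longlonglongrightarrow> 0 + 0"
    by (rule tendsto_add[OF LIMSEQ_inverse_real_of_nat])
  have le: "norm (dist (b n) l) \<le> inverse (real (Suc n)) + dist (a n) l" for n
    using dist_triangle[of "b n" l "a n"] dist_lt[of n] by simp
  have "(\<lambda>n. dist (b n) l) \<longlonglongrightarrow> 0"
    by (rule Lim_null_comparison[OF always_eventually]) (use le lim in simp_all)
  then show ?thesis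
    by (simp only: tendsto_dist_iff[symmetric])
qed

text \<open>Separation of codes makes the limit of points with convergent codes unique; boundedness
  of convergent codes traps such points in one compact \<open>K m\<close>, so that a limit exists.
  Together they extend the inverse of \<open>s\<close> continuously to the closure of its image. The
  bound \<open>4 * real m + 2\<close> turns tightness into tightness of the image measures on the
  line.\<close>

lemma ex_coding_sigma_compact:
  fixes K :: "nat \<Rightarrow> 'a::{metric_space, second_countable_topology} set"
  assumes K: "\<And>m. compact (K m)" and inc: "incseq K"
  obtains s :: "'a \<Rightarrow> real" and D :: "real set" and g
  where "s \<in> borel_measurable borel" "closed D" "continuous_on D g"
    "\<And>m x. x \<in> K m \<Longrightarrow> s x \<in> D \<and> g (s x) = x \<and> 0 \<le> s x \<and> s x \<le> 4 * real m + 2"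
proof -
  obtain c :: "'a \<Rightarrow> real" where c[measurable]: "c \<in> borel_measurable borel"
    and c_ge: "\<And>x. 0 \<le> c x" and c_le: "\<And>x. c x \<le> 2"
    and c_sep: "\<And>x y. x \<noteq> y \<Longrightarrow> \<exists>U V e. open U \<and> open V \<and> x \<in> U \<and> y \<in> V \<and> 0 < e \<and>
        (\<forall>u\<in>U. \<forall>v\<in>V. e \<le> \<bar>c u - c v\<bar>)"
    using ex_locally_separating_code by metis
  define S where "S = (\<Union>m. K m)"
  define L where "L x = (LEAST m. x \<in> K m)" for x
  \<comment> \<open>As \<open>c\<close> has range \<open>[0, 2]\<close>, points with different \<open>L\<close> have codes at distance at least \<open>2\<close>, so adding
    \<open>4 L\<close> keeps the separation property of \<open>c\<close>; and points with bounded codes lie in one \<open>K m\<close>.\<close>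
  define s where "s x = 4 * real (L x) + c x" for x
  have [measurable]: "K m \<in> sets borel" for m
    using K by (simp add: compact_imp_closed)
  have s_meas: "s \<in> borel_measurable borel"
    unfolding s_def L_def by measurable
  have L_le: "L x \<le> m" if "x \<in> K m" for x m
    unfolding L_def using that by (rule Least_le)
  have L_in: "x \<in> K (L x)" if "x \<in> S" for x
    using that unfolding S_def L_def by (auto intro: LeastI)
  have s_bd: "0 \<le> s x" "s x \<le> 4 * real m + 2" if "x \<in> K m" for x m
    using L_le[OF that] c_ge[of x] c_le[of x] by (auto simp: s_def)
  have sep: "\<exists>U V e. open U \<and> open V \<and> x \<in> U \<and> y \<in> V \<and> 0 < e \<and>
        (\<forall>u\<in>U. \<forall>v\<in>V. e \<le> \<bar>s u - s v\<bar>)" if "x \<noteq> y" for x y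
  proof -
    obtain U V e where UVe: "open U" "open V" "x \<in> U" "y \<in> V" "0 < e"
      "\<And>u v. u \<in> U \<Longrightarrow> v \<in> V \<Longrightarrow> e \<le> \<bar>c u - c v\<bar>"
      using c_sep[OF \<open>x \<noteq> y\<close>] by blast
    have "e \<le> \<bar>s u - s v\<bar>" if "u \<in> U" "v \<in> V" for u v
    proof (cases "L u = L v")
      case True
      then show ?thesis using UVe(6)[OF that] by (simp add: s_def)
    next
      case False
      then have "1 \<le> \<bar>real (L u) - real (L v)\<bar>" by linarith
      then show ?thesis
        using UVe(6)[OF that] c_ge[of u] c_le[of u] c_ge[of v] c_le[of v] unfolding s_def by linarith
    qed
    then show ?thesis using UVe by blast
  qed
  \<comment> \<open>\<open>P\<close> is the closure of the graph of the inverse of \<open>s\<close>.\<close>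
  define P where "P t x \<longleftrightarrow> (\<exists>u. range u \<subseteq> S \<and> (\<lambda>n. s (u n)) \<longlonglongrightarrow> t \<and> u \<longlonglongrightarrow> x)" for t x
  \<comment> \<open>If \<open>x\<close> and \<open>y\<close> differed, the codes along the two
    sequences would stay \<open>e\<close> apart, although both tend to \<open>t\<close>.\<close>
  have P_unique: "x = y" if xP: "P t x" and yP: "P t y" for t x y
  proof (rule ccontr)
    assume "x \<noteq> y"
    obtain U V e where UVe: "open U" "open V" "x \<in> U" "y \<in> V" "0 < e"
      "\<And>u v. u \<in> U \<Longrightarrow> v \<in> V \<Longrightarrow> e \<le> \<bar>s u - s v\<bar>"
      using sep[OF \<open>x \<noteq> y\<close>] by blast
    obtain u v where u: "(\<lambda>n. s (u n)) \<longlonglongrightarrow> t" "u \<longlonglongrightarrow> x" and v: "(\<lambda>n. s (v n)) \<longlonglongrightarrow> t" "v \<longlonglongrightarrow> y"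
      using xP yP unfolding P_def by blast
    have "eventually (\<lambda>n. e \<le> \<bar>s (u n) - s (v n)\<bar>) sequentially"
      using topological_tendstoD[OF u(2) UVe(1,3)] topological_tendstoD[OF v(2) UVe(2,4)]
      by eventually_elim (rule UVe(6))
    moreover have "(\<lambda>n. \<bar>s (u n) - s (v n)\<bar>) \<longlonglongrightarrow> \<bar>t - t\<bar>"
      by (intro tendsto_intros u v)
    ultimately have "e \<le> \<bar>t - t\<bar>"
      by (intro tendsto_lowerbound) auto
    then show False using UVe(5) by simp
  qed
  \<comment> \<open>Convergent codes are bounded, which bounds \<open>L\<close> along
    \<open>v\<close>; hence \<open>v\<close> stays in a single compact \<open>K M\<close>.\<close>
  have P_subseq: "\<exists>r x. strict_mono r \<and> P t x \<and> (v \<circ> r) \<longlonglongrightarrow> x"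
    if v: "range v \<subseteq> S" and lim: "(\<lambda>n. s (v n)) \<longlonglongrightarrow> t" for v :: "nat \<Rightarrow> 'a" and t
  proof -
    have "bounded (range (\<lambda>n. s (v n)))"
      using lim by (auto intro: convergent_imp_bounded simp: convergent_def)
    then obtain C where C: "\<And>n. \<bar>s (v n)\<bar> \<le> C"
      by (auto simp: bounded_iff)
    obtain M where M: "C \<le> real M"
      using real_arch_simple by blast
    have vK: "v n \<in> K M" for n
    proof -
      have "real (L (v n)) \<le> real M"
        using C[of n] M c_ge[of "v n"] unfolding s_def by linarith
      then show ?thesis
        using L_in[of "v n"] v monoD[OF inc, of "L (v n)" M] by auto
    qed
    obtain x r where "strict_mono r" "(v \<circ> r) \<longlonglongrightarrow> x"
      using seq_compactE[OF compact_imp_seq_compact[OF K[of M]], of v] vK by blast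
    moreover have "P t x"
      unfolding P_def
    proof (intro exI conjI)
      show "range (v \<circ> r) \<subseteq> S" "(v \<circ> r) \<longlonglongrightarrow> x"
        using v \<open>(v \<circ> r) \<longlonglongrightarrow> x\<close> by auto
      show "(\<lambda>n. s ((v \<circ> r) n)) \<longlonglongrightarrow> t"
        using LIMSEQ_subseq_LIMSEQ[OF lim \<open>strict_mono r\<close>] by (simp add: o_def)
    qed
    ultimately show ?thesis by blast
  qed
  define D where "D = closure (s ` S)"
  define g where "g t = (THE x. P t x)" for t
  have gP: "P t (g t)" if "t \<in> D" for t
  proof -
    obtain w where w: "\<forall>n. w n \<in> s ` S" "w \<longlonglongrightarrow> t"
      using \<open>t \<in> D\<close> unfolding D_def closure_sequential by blast
    then have "\<forall>n. \<exists>v. v \<in> S \<and> w n = s v" by blast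
    then obtain v where v: "\<And>n. v n \<in> S" "w = (\<lambda>n. s (v n))"
      by metis
    obtain x where x: "P t x"
      using P_subseq[of v t] v(1) w(2) unfolding v(2) by blast
    then have "g t = x"
      unfolding g_def using P_unique[OF _ x] by (rule the_equality)
    with x show ?thesis by simp
  qed
  \<comment> \<open>A subsequence avoiding a neighbourhood of \<open>g t\<close> would have a
    further subsequence with a limit \<open>x\<close> satisfying \<open>P t x\<close>, and
    uniqueness forces \<open>x = g t\<close>.\<close>
  have P_lim: "v \<longlonglongrightarrow> g t" if v: "range v \<subseteq> S" and lim: "(\<lambda>n. s (v n)) \<longlonglongrightarrow> t" and "t \<in> D" for v t
  proof (rule topological_tendstoI, rule ccontr)
    fix O' assume O': "open O'" "g t \<in> O'" and "\<not> eventually (\<lambda>n. v n \<in> O') sequentially"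
    then obtain r :: "nat \<Rightarrow> nat" where r: "strict_mono r" "\<And>n. v (r n) \<notin> O'"
      using not_eventually_sequentiallyD by blast
    obtain r' x where r': "strict_mono r'" "P t x" "(v \<circ> r \<circ> r') \<longlonglongrightarrow> x"
    proof -
      have "range (v \<circ> r) \<subseteq> S" "(\<lambda>n. s ((v \<circ> r) n)) \<longlonglongrightarrow> t"
        using v LIMSEQ_subseq_LIMSEQ[OF lim r(1)] by (auto simp: o_def)
      then show thesis
        using P_subseq[of "v \<circ> r" t] that by blast
    qed
    then have "x = g t" using P_unique gP \<open>t \<in> D\<close> by blast
    then have "eventually (\<lambda>n. (v \<circ> r \<circ> r') n \<in> O') sequentially"
      using topological_tendstoD[OF r'(3)] O' by simp
    then show False using r(2) by simp
  qed
  have cont: "continuous_on D g"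
    unfolding continuous_on_sequentially
  proof (intro allI ballI impI, elim conjE)
    fix w t assume t: "t \<in> D" and w: "\<forall>n. w n \<in> D" "w \<longlonglongrightarrow> t"
    \<comment> \<open>Diagonal choice: \<open>w n\<close> is only a limit of codes, so it is
      replaced by the code of a point \<open>v n\<close> of \<open>S\<close> that is also close to
      \<open>g (w n)\<close>; then \<open>P_lim\<close> applies to \<open>v\<close>.\<close>
    have "\<exists>v\<in>S. dist (s v) (w n) < inverse (real (Suc n)) \<and> dist v (g (w n)) < inverse (real (Suc n))"
      for n
    proof -
      obtain u where u: "range u \<subseteq> S" "(\<lambda>k. s (u k)) \<longlonglongrightarrow> w n" "u \<longlonglongrightarrow> g (w n)"
        using gP w(1) unfolding P_def by blast
      have "eventually (\<lambda>k. dist (s (u k)) (w n) < inverse (real (Suc n)) \<and>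
          dist (u k) (g (w n)) < inverse (real (Suc n))) sequentially"
        by (intro eventually_conj tendstoD u) auto
      then show ?thesis
        using u(1) by (force simp: eventually_sequentially)
    qed
    then obtain v where v: "\<And>n. v n \<in> S" "\<And>n. dist (s (v n)) (w n) < inverse (real (Suc n))"
      "\<And>n. dist (v n) (g (w n)) < inverse (real (Suc n))"
      by metis
    have "(\<lambda>n. s (v n)) \<longlonglongrightarrow> t"
      using w(2) v(2) by (rule tendsto_of_dist_less_inverse_Suc)
    then have "v \<longlonglongrightarrow> g t"
      using P_lim[of v t] v(1) t by auto
    then show "(g \<circ> w) \<longlonglongrightarrow> g t"
      unfolding o_def by (rule tendsto_of_dist_less_inverse_Suc) (use v(3) in \<open>simp add: dist_commute\<close>)
  qed
  have dec: "s x \<in> D \<and> g (s x) = x \<and> 0 \<le> s x \<and> s x \<le> 4 * real m + 2" if "x \<in> K m" for x m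
  proof -
    have "x \<in> S" using that by (auto simp: S_def)
    then have "s x \<in> D"
      unfolding D_def by (intro subsetD[OF closure_subset] imageI)
    moreover have "P (s x) x"
      unfolding P_def using \<open>x \<in> S\<close> by (intro exI[of _ "\<lambda>_. x"]) auto
    ultimately have "g (s x) = x"
      using P_unique gP by metis
    then show ?thesis
      using \<open>s x \<in> D\<close> s_bd[OF that] by simp
  qed
  have "closed D"
    unfolding D_def by (rule closed_closure)
  from s_meas this cont dec show thesis
    by (rule that)
qed

section \<open>Narrow convergence and tightness\<close>

text \<open>Phrased by test functions and not through \<open>narrow_topology\<close>, since only
  sequences occur below. Membership in \<open>borel_probs\<close> is not part of it and is stated
  separately.\<close>

definition narrowly_converges ::
    "(nat \<Rightarrow> 'a::topological_space measure) \<Rightarrow> 'a measure \<Rightarrow> bool" where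
  "narrowly_converges M \<mu> \<longleftrightarrow>
     (\<forall>f \<in> bounded_continuous. (\<lambda>n. \<integral>x. f x \<partial>M n) \<longlonglongrightarrow> (\<integral>x. f x \<partial>\<mu>))"

definition uniformly_tight :: "(nat \<Rightarrow> 'a::topological_space measure) \<Rightarrow> bool" where
  "uniformly_tight M \<longleftrightarrow> (\<forall>e>0. \<exists>K. compact K \<and> (\<forall>n. measure (M n) (- K) \<le> e))"

lemma narrowly_converges_subseq:
  "narrowly_converges M \<mu> \<Longrightarrow> strict_mono r \<Longrightarrow> narrowly_converges (\<lambda>n. M (r n)) \<mu>"
  unfolding narrowly_converges_def using LIMSEQ_subseq_LIMSEQ by (fastforce simp: o_def)

text \<open>The laws of the code \<open>s\<close> are tight on the real line and have a weak limit
  \<open>T\<close> along a subsequence. It is carried by the closed set \<open>D\<close>, so pushing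
  it forward along the decoding map \<open>g\<close> yields the limit measure.\<close>

theorem prokhorov_subsequence:
  fixes M :: "nat \<Rightarrow> 'a::{metric_space, second_countable_topology} measure"
  assumes M: "\<And>n. M n \<in> borel_probs" and tight: "uniformly_tight M"
  obtains r \<mu> where "strict_mono r" "\<mu> \<in> borel_probs" "narrowly_converges (\<lambda>n. M (r n)) \<mu>"
proof -
  have sets_M [measurable_cong]: "sets (M n) = sets borel" for n
    using M by (simp add: borel_probs_iff)
  have space_M [simp]: "space (M n) = UNIV" for n
    using sets_eq_imp_space_eq[OF sets_M] by simp
  interpret M: prob_space "M n" for n
    using M by (simp add: borel_probs_iff)
  have "\<forall>m. \<exists>K. compact K \<and> (\<forall>n. measure (M n) (- K) \<le> inverse (real (Suc m)))"
    using tight unfolding uniformly_tight_def by simp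
  then obtain C where C: "\<And>m. compact (C m)" "\<And>m n. measure (M n) (- C m) \<le> inverse (real (Suc m))"
    by metis
  \<comment> \<open>Finite unions make the compact sets increasing, as the coding lemma
    requires.\<close>
  define K where "K m = (\<Union>i\<le>m. C i)" for m
  have K: "compact (K m)" for m
    unfolding K_def using C(1) by (intro compact_UN) auto
  have incK: "incseq K"
    unfolding K_def incseq_def by force
  have [measurable]: "K m \<in> sets borel" "C m \<in> sets borel" for m
    using K C(1) by (simp_all add: compact_imp_closed)
  have K_small: "measure (M n) (- K m) \<le> inverse (real (Suc m))" for n m
  proof -
    have "measure (M n) (- K m) \<le> measure (M n) (- C m)"
      by (rule M.finite_measure_mono) (auto simp: K_def sets_M)
    then show ?thesis using C(2)[of n m] by linarith
  qed
  obtain s D g where s [measurable]: "s \<in> borel_measurable borel"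
    and D: "closed D" and g: "continuous_on D g"
    and dec: "\<And>m x. x \<in> K m \<Longrightarrow> s x \<in> D \<and> g (s x) = x \<and> 0 \<le> s x \<and> s x \<le> 4 * real m + 2"
    using ex_coding_sigma_compact[OF K incK] by blast
  have s_M [measurable]: "s \<in> borel_measurable (M n)" for n
    using s measurable_cong_sets[OF sets_M refl] by blast
  have AE_K: "AE x in M n. x \<in> (\<Union>m. K m)" for n
  proof -
    have "measure (M n) (- (\<Union>m. K m)) \<le> inverse (real (Suc m))" for m
    proof -
      have "measure (M n) (- (\<Union>m. K m)) \<le> measure (M n) (- K m)"
        by (rule M.finite_measure_mono) (auto simp: sets_M)
      then show ?thesis using K_small[of n m] by linarith
    qed
    then have "measure (M n) (- (\<Union>m. K m)) \<le> 0"
      by (intro LIMSEQ_le_const[OF LIMSEQ_inverse_real_of_nat]) auto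
    then have "emeasure (M n) (- (\<Union>m. K m)) = 0"
      by (simp add: M.emeasure_eq_measure measure_le_0_iff)
    then show ?thesis
      by (intro AE_I'[of "- (\<Union>m. K m)"]) (auto simp: null_sets_def sets_M)
  qed
  define \<tau> where "\<tau> n = distr (M n) borel s" for n
  have real_\<tau>: "real_distribution (\<tau> n)" for n
    unfolding \<tau>_def by (intro M.real_distribution_distr s_M)
  have "tight \<tau>"
    unfolding tight_def
  proof (intro conjI allI impI real_\<tau>)
    fix e :: real assume "e > 0"
    then obtain m where m: "inverse (real (Suc m)) < e"
      using reals_Archimedean by blast
    \<comment> \<open>\<open>tight\<close> is stated with intervals open on the left; the endpoint
      \<open>-1\<close> keeps the possible code 0 inside.\<close>
    have "1 - e < measure (\<tau> n) {-1<..4 * real m + 2}" for n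
    proof -
      have "1 - e < 1 - measure (M n) (- K m)"
        using K_small[of n m] m by linarith
      also have "\<dots> = measure (M n) (K m)"
        using M.prob_compl[of "K m" n] by (simp add: sets_M Compl_eq_Diff_UNIV)
      also have "\<dots> \<le> measure (M n) (s -` {-1<..4 * real m + 2} \<inter> space (M n))"
      proof (rule M.finite_measure_mono)
        show "K m \<subseteq> s -` {-1<..4 * real m + 2} \<inter> space (M n)"
          using dec by fastforce
      qed measurable
      also have "\<dots> = measure (\<tau> n) {-1<..4 * real m + 2}"
        unfolding \<tau>_def by (subst measure_distr) auto
      finally show ?thesis .
    qed
    then show "\<exists>a b. a < b \<and> (\<forall>n. 1 - e < measure (\<tau> n) {a<..b})"
      by (intro exI[of _ "-1"] exI[of _ "4 * real m + 2"]) auto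
  qed
  \<comment> \<open>Helly's selection theorem, applied to the trivial subsequence
    \<open>id\<close>.\<close>
  then obtain r T where r: "strict_mono r" and T: "real_distribution T"
    and conv: "weak_conv_m (\<tau> \<circ> id \<circ> r) T"
    using tight_imp_convergent_subsubsequence[of \<tau> id] by (auto simp: strict_mono_def)
  interpret T: real_distribution T by (rule T)
  have lim: "(\<lambda>n. \<integral>x. h (s x) \<partial>M (r n)) \<longlonglongrightarrow> (\<integral>t. h t \<partial>T)"
    if h: "continuous_on UNIV h" "\<And>t. \<bar>h t\<bar> \<le> B" for h :: "real \<Rightarrow> real" and B
  proof -
    have "(\<lambda>n. \<integral>t. h t \<partial>((\<tau> \<circ> id \<circ> r) n)) \<longlonglongrightarrow> (\<integral>t. h t \<partial>T)"
    proof (rule weak_conv_imp_integral_bdd_continuous_conv)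
      show "isCont h t" for t
        using h(1) by (simp add: continuous_on_eq_continuous_at)
      show "norm (h t) \<le> B" for t
        using h(2) by simp
    qed (use real_\<tau> T conv in \<open>auto simp: o_def\<close>)
    moreover have "(\<integral>t. h t \<partial>((\<tau> \<circ> id \<circ> r) n)) = (\<integral>x. h (s x) \<partial>M (r n))" for n
      unfolding \<tau>_def o_def id_def
      using h(1) by (intro integral_distr) (auto intro: borel_measurable_continuous_onI)
    ultimately show ?thesis by simp
  qed
  \<comment> \<open>\<open>infdist\<close> to the empty set is 0 by convention; for nonempty closed
    \<open>D\<close> its zeros are exactly the points of \<open>D\<close>.\<close>
  have "D \<noteq> {}"
  proof
    assume "D = {}"
    then have "K m = {}" for m
      using dec by blast
    then show False
      using AE_K[of 0] by simp
  qed
  have AE_D: "AE t in T. t \<in> D"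
  proof -
    \<comment> \<open>A bounded continuous function that vanishes exactly on \<open>D\<close>. Its
      integrals against the image laws are 0, hence so is the one against \<open>T\<close>.\<close>
    define h where "h t = min 1 (infdist t D)" for t
    have h: "continuous_on UNIV h" "\<bar>h t\<bar> \<le> 1" "0 \<le> h t" for t
      using infdist_nonneg[of t D] unfolding h_def by (auto intro!: continuous_intros)
    have hD: "h t = 0 \<longleftrightarrow> t \<in> D" for t
      using in_closed_iff_infdist_zero[OF D \<open>D \<noteq> {}\<close>, of t] by (auto simp: h_def min_def)
    have "(\<integral>x. h (s x) \<partial>M n) = 0" for n
      using AE_K[of n] by (intro integral_eq_zero_AE) (auto elim!: eventually_mono simp: hD dec)
    then have "(\<integral>t. h t \<partial>T) = 0"
      using lim[of h 1] h LIMSEQ_unique[OF _ tendsto_const] by auto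
    moreover have "integrable T h"
      using h by (intro T.integrable_const_bound[of _ 1]) (auto simp: borel_measurable_continuous_onI)
    ultimately have "AE t in T. h t = 0"
      using integral_nonneg_eq_0_iff_AE[of T h] h(3) by simp
    then show ?thesis by (simp add: hD)
  qed
  \<comment> \<open>The value off \<open>D\<close> is arbitrary, as \<open>T\<close> gives no mass
    there; this makes the decoding map total and Borel.\<close>
  define g' where "g' t = (if t \<in> D then g t else undefined)" for t
  have [measurable]: "g' \<in> borel_measurable borel"
    unfolding g'_def using D g by (intro borel_measurable_continuous_on_if) auto
  define \<mu> where "\<mu> = distr T borel g'"
  have "\<mu> \<in> borel_probs"
    unfolding \<mu>_def borel_probs_iff by (auto intro: T.prob_space_distr)
  moreover have "narrowly_converges (\<lambda>n. M (r n)) \<mu>"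
    unfolding narrowly_converges_def
  proof
    fix f :: "'a \<Rightarrow> real" assume f: "f \<in> bounded_continuous"
    then have fc: "continuous_on UNIV f" by (simp add: bounded_continuous_def)
    then have fm: "f \<in> borel_measurable borel" by (rule borel_measurable_continuous_onI)
    obtain B where B: "\<And>x. \<bar>f x\<bar> \<le> B"
      using f by (auto simp: bounded_continuous_def bounded_iff)
    then have "0 \<le> B" by (metis abs_ge_zero order_trans)
    \<comment> \<open>The Tietze extension of \<open>f \<circ> g\<close> keeps the bound
      \<open>B\<close>, so it is a test function on the line; composed with \<open>s\<close> it
      agrees with \<open>f\<close> almost everywhere under each \<open>M n\<close>.\<close>
    obtain h where h: "continuous_on UNIV h" "\<And>t. t \<in> D \<Longrightarrow> h t = f (g t)" "\<And>t. \<bar>h t\<bar> \<le> B"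
    proof (rule Tietze[of D "\<lambda>t. f (g t)" UNIV B])
      show "continuous_on D (\<lambda>t. f (g t))"
        by (rule continuous_on_compose2[OF fc g]) simp
    qed (use D B \<open>0 \<le> B\<close> that in auto)
    have hm: "h \<in> borel_measurable borel"
      using h(1) by (rule borel_measurable_continuous_onI)
    have "(\<integral>x. h (s x) \<partial>M n) = (\<integral>x. f x \<partial>M n)" for n
    proof (rule integral_cong_AE)
      show "AE x in M n. h (s x) = f x"
        using AE_K[of n] by (rule eventually_mono) (use dec h(2) in force)
      show "f \<in> borel_measurable (M n)"
        using fm measurable_cong_sets[OF sets_M refl] by blast
      show "(\<lambda>x. h (s x)) \<in> borel_measurable (M n)"
        using hm by measurable
    qed
    moreover have "(\<integral>t. h t \<partial>T) = (\<integral>x. f x \<partial>\<mu>)"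
    proof -
      have "(\<integral>x. f x \<partial>\<mu>) = (\<integral>t. f (g' t) \<partial>T)"
        unfolding \<mu>_def using fm by (intro integral_distr) auto
      also have "\<dots> = (\<integral>t. h t \<partial>T)"
      proof (rule integral_cong_AE)
        show "AE t in T. f (g' t) = h t"
          using AE_D by (rule eventually_mono) (simp add: g'_def h(2))
        show "(\<lambda>t. f (g' t)) \<in> borel_measurable T" "h \<in> borel_measurable T"
          using fm hm by simp_all
      qed
      finally show ?thesis by simp
    qed
    ultimately show "(\<lambda>n. \<integral>x. f x \<partial>M (r n)) \<longlonglongrightarrow> (\<integral>x. f x \<partial>\<mu>)"
      using lim[OF h(1,3)] by simp
  qed
  ultimately show thesis
    using that r by blast
qed

section \<open>Lower semicontinuity and a criterion for tightness\<close>

lemma borel_measurable_continuous_borel_probs: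
  assumes "continuous_on UNIV f" "M \<in> borel_probs"
  shows "f \<in> borel_measurable M"
proof -
  have "sets M = sets borel"
    using assms(2) by (simp add: borel_probs_iff)
  from measurable_cong_sets[OF this refl] borel_measurable_continuous_onI[OF assms(1)]
  show ?thesis by blast
qed

text \<open>The truncations of \<open>c\<close> at height \<open>k\<close> are bounded and
  continuous, so their integrals pass to the limit and stay below \<open>L\<close>; monotone
  convergence in \<open>k\<close> recovers \<open>c\<close>.\<close>

lemma nn_integral_le_of_narrowly_converges:
  fixes c :: "'a::topological_space \<Rightarrow> real"
  assumes M: "\<And>n. M n \<in> borel_probs" and \<mu>: "\<mu> \<in> borel_probs"
    and conv: "narrowly_converges M \<mu>"
    and c: "continuous_on UNIV c" "\<And>x. 0 \<le> c x"
    and le: "\<And>n. (\<integral>\<^sup>+x. ennreal (c x) \<partial>M n) \<le> b n" and b: "b \<longlonglongrightarrow> L"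
  shows "(\<integral>\<^sup>+x. ennreal (c x) \<partial>\<mu>) \<le> L"
proof -
  define f where "f k x = min (c x) (real k)" for k x
  have f: "continuous_on UNIV (f k)" "0 \<le> f k x" "f k x \<le> real k" "f k x \<le> c x" for k x
    using c unfolding f_def by (auto intro!: continuous_intros)
  have bc: "f k \<in> bounded_continuous" for k
    unfolding bounded_continuous_def bounded_iff using f[of k] by (auto intro!: exI[of _ "real k"])
  have f_meas: "f k \<in> borel_measurable N" if "N \<in> borel_probs" for k N
    using f(1) that by (rule borel_measurable_continuous_borel_probs)
  have nn: "(\<integral>\<^sup>+x. ennreal (f k x) \<partial>N) = ennreal (\<integral>x. f k x \<partial>N)" if N: "N \<in> borel_probs" for k N
  proof (rule nn_integral_eq_integral)
    interpret N: prob_space N using N by (simp add: borel_probs_iff)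
    show "integrable N (f k)"
      using f f_meas[OF N] by (intro N.integrable_const_bound[of _ "real k"]) auto
  qed (use f in simp)
  have le_k: "(\<integral>\<^sup>+x. ennreal (f k x) \<partial>\<mu>) \<le> L" for k
  proof (rule LIMSEQ_le[OF _ b])
    show "(\<lambda>n. \<integral>\<^sup>+x. ennreal (f k x) \<partial>M n) \<longlonglongrightarrow> (\<integral>\<^sup>+x. ennreal (f k x) \<partial>\<mu>)"
      unfolding nn[OF M] nn[OF \<mu>] using conv bc
      by (intro tendsto_ennrealI) (auto simp: narrowly_converges_def)
    have "(\<integral>\<^sup>+x. ennreal (f k x) \<partial>M n) \<le> b n" for n
      using f(4) by (intro order_trans[OF nn_integral_mono le]) (auto intro: ennreal_leI)
    then show "\<exists>N. \<forall>n\<ge>N. (\<integral>\<^sup>+x. ennreal (f k x) \<partial>M n) \<le> b n" by blast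
  qed
  have SUP_f: "(SUP k. ennreal (f k x)) = ennreal (c x)" for x
  proof (rule antisym)
    show "(SUP k. ennreal (f k x)) \<le> ennreal (c x)"
      using f(4) by (intro SUP_least ennreal_leI)
    obtain k where "c x \<le> real k" using real_arch_simple by blast
    then have "ennreal (c x) \<le> ennreal (f k x)" by (simp add: f_def)
    then show "ennreal (c x) \<le> (SUP k. ennreal (f k x))"
      by (rule SUP_upper2[OF UNIV_I])
  qed
  have "(\<integral>\<^sup>+x. ennreal (c x) \<partial>\<mu>) = (SUP k. \<integral>\<^sup>+x. ennreal (f k x) \<partial>\<mu>)"
    unfolding SUP_f[symmetric]
  proof (rule nn_integral_monotone_convergence_SUP)
    show "incseq (\<lambda>k x. ennreal (f k x))"
      by (auto simp: incseq_def le_fun_def f_def intro!: ennreal_leI)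
    show "(\<lambda>x. ennreal (f k x)) \<in> borel_measurable \<mu>" for k
      using f_meas[OF \<mu>] by simp
  qed
  also have "\<dots> \<le> L"
    using le_k by (rule SUP_least)
  finally show ?thesis .
qed

text \<open>Markov's inequality: the mass outside the sublevel set at height \<open>R\<close> is at
  most \<open>B / R\<close>, uniformly in \<open>n\<close>.\<close>

lemma uniformly_tight_of_coercive:
  fixes \<phi> :: "'a::t2_space \<Rightarrow> ennreal"
  assumes M: "\<And>n. M n \<in> borel_probs"
    and cpt: "\<And>R :: real. compact {x. \<phi> x \<le> ennreal R}"
    and bd: "\<And>n. (\<integral>\<^sup>+x. \<phi> x \<partial>M n) \<le> B" and B: "B < \<infinity>"
  shows "uniformly_tight M"
  unfolding uniformly_tight_def
proof (intro allI impI)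
  fix e :: real assume e: "e > 0"
  obtain C where C: "0 \<le> C" "B = ennreal C"
    using B by (cases B) auto
  \<comment> \<open>The summand 1 keeps \<open>R\<close> positive even if \<open>C = 0\<close>, and
    \<open>C \<le> R * e\<close> still holds.\<close>
  define R where "R = (C + 1) / e"
  have R: "0 < R" using e C by (simp add: R_def)
  define K where "K = {x. \<phi> x \<le> ennreal R}"
  have K: "compact K" unfolding K_def by (rule cpt)
  have "measure (M n) (- K) \<le> e" for n
  proof -
    interpret prob_space "M n" using M by (simp add: borel_probs_iff)
    have Kn: "- K \<in> sets (M n)"
      using K M[of n] by (simp add: borel_probs_iff compact_imp_closed)
    have "ennreal R * emeasure (M n) (- K) = (\<integral>\<^sup>+x. ennreal R * indicator (- K) x \<partial>M n)"
      using Kn by (simp add: nn_integral_cmult_indicator)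
    also have "\<dots> \<le> (\<integral>\<^sup>+x. \<phi> x \<partial>M n)"
      by (intro nn_integral_mono) (auto simp: K_def indicator_def)
    also have "\<dots> \<le> ennreal C" using bd[of n] C by simp
    finally have "R * measure (M n) (- K) \<le> C"
      using R C by (simp add: emeasure_eq_measure ennreal_mult'[symmetric])
    also have "\<dots> \<le> R * e" using e by (simp add: R_def)
    finally show ?thesis using R by simp
  qed
  with K show "\<exists>K. compact K \<and> (\<forall>n. measure (M n) (- K) \<le> e)" by blast
qed


section \<open>Moments and couplings\<close>

lemma powr_add_le:
  fixes a b p :: real
  assumes "0 \<le> a" "0 \<le> b" "0 \<le> p"
  shows "(a + b) powr p \<le> 2 powr p * (a powr p + b powr p)"
proof -
  have "(a + b) powr p \<le> (2 * max a b) powr p"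
    using assms by (intro powr_mono2) auto
  also have "\<dots> = 2 powr p * max a b powr p"
    using assms by (simp add: powr_mult)
  also have "\<dots> \<le> 2 powr p * (a powr p + b powr p)"
    by (intro mult_left_mono) (auto simp: max_def)
  finally show ?thesis .
qed

text \<open>Positivity of \<open>p\<close> gives continuity at the zeros of
  \<open>f\<close>.\<close>

lemma continuous_on_norm_powr:
  fixes f :: "'a::topological_space \<Rightarrow> 'b::real_normed_vector"
  assumes "0 < p" "continuous_on S f"
  shows "continuous_on S (\<lambda>x. norm (f x) powr p)"
  using assms by (intro continuous_on_powr' continuous_intros) auto

text \<open>In finite dimension the sublevel sets of the \<open>p\<close>-th power of the norm are
  closed and bounded, hence compact.\<close>

lemma uniformly_tight_of_moment:
  fixes M :: "nat \<Rightarrow> 'b::euclidean_space measure"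
  assumes "0 < p" "\<And>n. M n \<in> borel_probs" "\<And>n. moment p (M n) \<le> B" "B < \<infinity>"
  shows "uniformly_tight M"
proof (rule uniformly_tight_of_coercive)
  fix R :: real
  let ?S = "{y :: 'b. ennreal (norm y powr p) \<le> ennreal R}"
  \<comment> \<open>\<open>ennreal\<close> sends negative reals to 0, hence
    \<open>max 0 R\<close>.\<close>
  have eq: "?S = {y. norm y powr p \<le> max 0 R}"
    by (auto simp: ennreal_le_iff2 max_def)
  have "closed ?S"
    unfolding eq using assms(1)
    by (intro closed_Collect_le continuous_on_norm_powr continuous_intros)
  moreover have "norm y \<le> max 0 R powr (1 / p)" if "y \<in> ?S" for y
  proof -
    have "norm y = (norm y powr p) powr (1 / p)"
      using assms(1) by (simp add: powr_powr)
    also have "\<dots> \<le> max 0 R powr (1 / p)"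
      using that assms(1) unfolding eq by (intro powr_mono2) auto
    finally show ?thesis .
  qed
  then have "bounded ?S"
    unfolding bounded_iff by blast
  ultimately show "compact ?S"
    by (simp add: compact_eq_bounded_closed)
qed (use assms in \<open>auto simp: moment_def\<close>)

text \<open>Turns a moment bound on the mixture into a bound on the \<sigma>-integral of the
  coercive function \<open>moment p (\<rho> x)\<close>, from which tightness on the parameter space
  follows.\<close>

lemma moment_mixture:
  fixes \<rho> :: "'a::topological_space \<Rightarrow> 'b::euclidean_space measure"
  assumes \<rho>: "markov_kernel \<rho>" and \<sigma>: "\<sigma> \<in> borel_probs"
  shows "moment p (mixture \<rho> \<sigma>) = (\<integral>\<^sup>+x. moment p (\<rho> x) \<partial>\<sigma>)"
  unfolding moment_def mixture_def
proof (rule nn_integral_bind[where B = borel])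
  have "\<rho> \<in> borel \<rightarrow>\<^sub>M subprob_algebra borel"
    using \<rho> by (simp add: markov_kernel_iff_measurable measurable_prob_algebraD)
  then show "\<rho> \<in> \<sigma> \<rightarrow>\<^sub>M subprob_algebra borel"
    using \<sigma> measurable_cong_sets[of \<sigma> borel] by (auto simp: borel_probs_iff)
qed measurable

lemma moment_coupling:
  fixes \<Gamma> :: "('b::euclidean_space \<times> 'b) measure"
  assumes \<Gamma>: "\<Gamma> \<in> couplings \<mu> \<nu>"
  shows "(\<integral>\<^sup>+z. ennreal (norm (fst z) powr p) \<partial>\<Gamma>) = moment p \<mu>"
    and "(\<integral>\<^sup>+z. ennreal (norm (snd z) powr p) \<partial>\<Gamma>) = moment p \<nu>"
proof -
  have s: "\<Gamma> \<in> borel_probs" and d: "distr \<Gamma> borel fst = \<mu>" "distr \<Gamma> borel snd = \<nu>"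
    using \<Gamma> by (auto simp: couplings_def)
  have "fst \<in> borel_measurable \<Gamma>" "snd \<in> borel_measurable \<Gamma>"
    using s by (intro borel_measurable_continuous_borel_probs continuous_intros; simp)+
  then show "(\<integral>\<^sup>+z. ennreal (norm (fst z) powr p) \<partial>\<Gamma>) = moment p \<mu>"
    "(\<integral>\<^sup>+z. ennreal (norm (snd z) powr p) \<partial>\<Gamma>) = moment p \<nu>"
    unfolding moment_def d[symmetric] by (simp_all add: nn_integral_distr)
qed

text \<open>Serves two estimates: the first marginal's moment by the cost and the second marginal's
  moment, and the moment of a coupling by those of its marginals. The separate type of
  \<open>f\<close> admits the product norm.\<close>

lemma nn_integral_norm_powr_le:
  fixes f :: "'a \<Rightarrow> 'b::real_normed_vector" and g h :: "'a \<Rightarrow> 'c::euclidean_space"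
  assumes [measurable]: "g \<in> borel_measurable M" "h \<in> borel_measurable M"
    and p: "0 \<le> p" and le: "\<And>z. norm (f z) \<le> norm (g z) + norm (h z)"
  shows "(\<integral>\<^sup>+z. ennreal (norm (f z) powr p) \<partial>M) \<le>
    ennreal (2 powr p) *
      ((\<integral>\<^sup>+z. ennreal (norm (g z) powr p) \<partial>M) + (\<integral>\<^sup>+z. ennreal (norm (h z) powr p) \<partial>M))"
proof -
  have "norm (f z) powr p \<le> 2 powr p * (norm (g z) powr p + norm (h z) powr p)" for z
  proof -
    have "norm (f z) powr p \<le> (norm (g z) + norm (h z)) powr p"
      using le[of z] p by (intro powr_mono2) auto
    also have "\<dots> \<le> 2 powr p * (norm (g z) powr p + norm (h z) powr p)"
      using p by (intro powr_add_le) auto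
    finally show ?thesis .
  qed
  then have "(\<integral>\<^sup>+z. ennreal (norm (f z) powr p) \<partial>M) \<le>
      (\<integral>\<^sup>+z. ennreal (2 powr p) * (ennreal (norm (g z) powr p) + ennreal (norm (h z) powr p)) \<partial>M)"
    by (intro nn_integral_mono)
      (simp add: ennreal_plus[symmetric] ennreal_mult[symmetric] ennreal_leI del: ennreal_plus)
  also have "\<dots> = ennreal (2 powr p) *
      ((\<integral>\<^sup>+z. ennreal (norm (g z) powr p) \<partial>M) + (\<integral>\<^sup>+z. ennreal (norm (h z) powr p) \<partial>M))"
    by (simp add: nn_integral_cmult nn_integral_add)
  finally show ?thesis .
qed

text \<open>Along \<open>u \<longlonglongrightarrow> x\<close> the measures
  \<open>\<rho> (u n)\<close> converge narrowly, so lower semicontinuity of the moment makes the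
  sublevel set closed. In a complete space, closed and totally bounded sets are compact.\<close>

lemma compact_moment_sublevel:
  fixes \<rho> :: "'a::polish_space \<Rightarrow> 'b::euclidean_space measure"
  assumes p: "0 < p" and kernel: "markov_kernel \<rho>"
    and cont: "continuous_map euclidean narrow_topology \<rho>"
    and tb: "totally_bounded {x. enn2ereal (moment p (\<rho> x)) \<le> ereal (max 0 R)}"
  shows "compact {x. moment p (\<rho> x) \<le> ennreal R}" (is "compact ?S")
proof -
  have "moment p (\<rho> x) \<le> ennreal R" if "\<And>n. moment p (\<rho> (u n)) \<le> ennreal R" "u \<longlonglongrightarrow> x" for u x
    unfolding moment_def
  proof (rule nn_integral_le_of_narrowly_converges[where b = "\<lambda>_. ennreal R"])
    show "narrowly_converges (\<lambda>n. \<rho> (u n)) (\<rho> x)"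
      unfolding narrowly_converges_def
    proof
      fix f :: "'b \<Rightarrow> real" assume "f \<in> bounded_continuous"
      then have "continuous_on UNIV (\<lambda>x. \<integral>y. f y \<partial>\<rho> x)"
        using cont unfolding continuous_map_narrow_topology_iff by simp
      then show "(\<lambda>n. \<integral>y. f y \<partial>\<rho> (u n)) \<longlonglongrightarrow> (\<integral>y. f y \<partial>\<rho> x)"
        using that(2) by (auto simp: continuous_on_sequentially o_def)
    qed
    show "continuous_on UNIV (\<lambda>y :: 'b. norm y powr p)"
      using p by (intro continuous_on_norm_powr continuous_intros)
    show "(\<integral>\<^sup>+y. ennreal (norm y powr p) \<partial>\<rho> (u n)) \<le> ennreal R" for n
      using that(1) by (simp add: moment_def)
  qed (use kernel in \<open>auto simp: markov_kernel_def\<close>)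
  then have "closed ?S"
    unfolding closed_sequential_limits by blast
  moreover have "totally_bounded ?S"
  proof (rule totally_bounded_subset[OF tb], rule subsetI)
    fix x assume "x \<in> ?S"
    moreover have "ennreal R = ennreal (max 0 R)" "enn2ereal (ennreal (max 0 R)) = ereal (max 0 R)"
      by (simp_all add: max_def ennreal_neg enn2ereal_ennreal)
    ultimately show "x \<in> {x. enn2ereal (moment p (\<rho> x)) \<le> ereal (max 0 R)}"
      by (simp only: mem_Collect_eq less_eq_ennreal.rep_eq)
  qed
  ultimately show ?thesis
    unfolding compact_eq_totally_bounded totally_bounded_metric complete_eq_closed ball_def by blast
qed

section \<open>The direct method for the Wasserstein problem\<close>

theorem theorem1p1:
  fixes \<rho> :: "'a::polish_space \<Rightarrow> (real ^ 'd) measure"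
    and \<nu> :: "(real ^ 'd) measure"
    and p :: real
  assumes p: "p \<ge> 1"
    and \<nu>: "\<nu> \<in> finite_moment_probs p"
    and kernel: "markov_kernel \<rho>"
    and CTY: "continuous_map euclidean narrow_topology \<rho>"
    and CRC: "\<And>c :: real. totally_bounded {x. enn2ereal (moment p (\<rho> x)) \<le> ereal c}"
  shows "\<exists>\<sigma>\<^sub>0 \<in> borel_probs. wasserstein_pow p (mixture \<rho> \<sigma>\<^sub>0) \<nu> =
           (INF \<sigma> \<in> borel_probs. wasserstein_pow p (mixture \<rho> \<sigma>) \<nu>)"
proof -
  define I where "I = (INF \<sigma> \<in> borel_probs. wasserstein_pow p (mixture \<rho> \<sigma>) \<nu>)"
  define cost where "cost \<Gamma> = (\<integral>\<^sup>+z. ennreal (norm (fst z - snd z) powr p) \<partial>\<Gamma>)"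
    for \<Gamma> :: "((real ^ 'd) \<times> (real ^ 'd)) measure"
  have I_le: "I \<le> wasserstein_pow p (mixture \<rho> \<sigma>) \<nu>" if "\<sigma> \<in> borel_probs" for \<sigma>
    unfolding I_def using that by (rule INF_lower)
  have W_le: "wasserstein_pow p \<mu> \<nu> \<le> cost \<Gamma>" if "\<Gamma> \<in> couplings \<mu> \<nu>" for \<mu> \<Gamma>
    unfolding wasserstein_pow_def cost_def using that by (rule INF_lower)
  show ?thesis
  proof (cases "I = \<infinity>")
    case True
    \<comment> \<open>If the infimum is infinite, every competitor attains it; a Dirac measure at an
      arbitrary point shows that there is one.\<close>
    have "return borel undefined \<in> (borel_probs :: 'a measure set)"
      by (simp add: borel_probs_iff prob_space_return)
    then show ?thesis
      using I_le[of "return borel undefined"] True unfolding I_def[symmetric]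
      by (intro bexI[of _ "return borel undefined"]) (auto simp: top_unique)
  next
    case False
    define b where "b n = I + ennreal (inverse (real (Suc n)))" for n
    have b_lim: "b \<longlonglongrightarrow> I"
      unfolding b_def using tendsto_add[OF tendsto_const tendsto_ennrealI[OF LIMSEQ_inverse_real_of_nat]]
      by simp
    have b_le: "b n \<le> I + 1" for n
      unfolding b_def by (intro add_left_mono) (simp add: inverse_le_1_iff)
    have "\<exists>\<sigma> \<Gamma>. \<sigma> \<in> borel_probs \<and> \<Gamma> \<in> couplings (mixture \<rho> \<sigma>) \<nu> \<and> cost \<Gamma> \<le> b n" for n
    proof -
      \<comment> \<open>Finiteness of \<open>I\<close> makes \<open>b n\<close> exceed it strictly.
        The same strict bound then serves for the infimum over couplings.\<close>
      obtain \<sigma> where \<sigma>: "\<sigma> \<in> borel_probs" "wasserstein_pow p (mixture \<rho> \<sigma>) \<nu> < b n"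
        using INF_approx_ennreal[OF _ I_def False, of "inverse (real (Suc n))"] by (auto simp: b_def)
      then obtain \<Gamma> where "\<Gamma> \<in> couplings (mixture \<rho> \<sigma>) \<nu>" "cost \<Gamma> < b n"
        unfolding wasserstein_pow_def cost_def INF_less_iff by blast
      with \<sigma> show ?thesis by (blast intro: less_imp_le)
    qed
    then obtain \<sigma> \<Gamma> where \<sigma>: "\<And>n. \<sigma> n \<in> borel_probs"
      and \<Gamma>: "\<And>n. \<Gamma> n \<in> couplings (mixture \<rho> (\<sigma> n)) \<nu>" and cost_le: "\<And>n. cost (\<Gamma> n) \<le> b n"
      by metis
    have \<Gamma>_prob: "\<Gamma> n \<in> borel_probs" for n
      using \<Gamma> by (simp add: couplings_def)
    have [measurable]: "fst \<in> borel_measurable (\<Gamma> n)" "snd \<in> borel_measurable (\<Gamma> n)"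
      "(\<lambda>z. fst z - snd z) \<in> borel_measurable (\<Gamma> n)" for n
      using \<Gamma>_prob by (intro borel_measurable_continuous_borel_probs continuous_intros; simp)+
    \<comment> \<open>Comes from splitting the first coordinate into the difference and the second
      coordinate; \<open>I + 1\<close> bounds every cost.\<close>
    define B where "B = ennreal (2 powr p) * ((I + 1) + moment p \<nu>)"
    have \<nu>_fin: "moment p \<nu> < \<infinity>"
      using \<nu> by (simp add: finite_moment_probs_def)
    have B: "B < \<infinity>"
      using False \<nu>_fin by (simp add: B_def ennreal_mult_less_top less_top)
    have mix_le: "moment p (mixture \<rho> (\<sigma> n)) \<le> B" for n
    proof -
      have "moment p (mixture \<rho> (\<sigma> n)) = (\<integral>\<^sup>+z. ennreal (norm (fst z) powr p) \<partial>\<Gamma> n)"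
        using moment_coupling(1)[OF \<Gamma>] by simp
      also have "\<dots> \<le> ennreal (2 powr p) * (cost (\<Gamma> n) + (\<integral>\<^sup>+z. ennreal (norm (snd z) powr p) \<partial>\<Gamma> n))"
        unfolding cost_def
        by (rule nn_integral_norm_powr_le)
          (use p in \<open>auto intro: order_trans[OF _ norm_triangle_ineq]\<close>)
      also have "\<dots> \<le> B"
        unfolding B_def moment_coupling(2)[OF \<Gamma>]
        by (intro mult_left_mono add_right_mono order_trans[OF cost_le b_le]) simp
      finally show ?thesis .
    qed
    have "moment p (\<Gamma> n) \<le> ennreal (2 powr p) * (B + moment p \<nu>)" for n
    proof -
      have "moment p (\<Gamma> n) \<le> ennreal (2 powr p) *
          ((\<integral>\<^sup>+z. ennreal (norm (fst z) powr p) \<partial>\<Gamma> n) + (\<integral>\<^sup>+z. ennreal (norm (snd z) powr p) \<partial>\<Gamma> n))"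
        unfolding moment_def[of p "\<Gamma> n"]
        by (rule nn_integral_norm_powr_le) (use p norm_Pair_le in auto)
      also have "\<dots> \<le> ennreal (2 powr p) * (B + moment p \<nu>)"
        unfolding moment_coupling[OF \<Gamma>] by (intro mult_left_mono add_right_mono mix_le) simp
      finally show ?thesis .
    qed
    moreover have "ennreal (2 powr p) * (B + moment p \<nu>) < \<infinity>"
      using B \<nu>_fin by (simp add: ennreal_mult_less_top)
    \<comment> \<open>Stated along any \<open>r\<close>, because the couplings are extracted after a
      subsequence for \<open>\<sigma>\<close> has been fixed; both then converge along the
      composition.\<close>
    ultimately have tight_\<Gamma>: "uniformly_tight (\<lambda>n. \<Gamma> (r n))" for r :: "nat \<Rightarrow> nat"
      using p \<Gamma>_prob by (intro uniformly_tight_of_moment) auto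
    have "uniformly_tight \<sigma>"
    proof (rule uniformly_tight_of_coercive[OF \<sigma> _ _ B])
      show "compact {x. moment p (\<rho> x) \<le> ennreal R}" for R
        using p by (intro compact_moment_sublevel kernel CTY CRC) simp
      show "(\<integral>\<^sup>+x. moment p (\<rho> x) \<partial>\<sigma> n) \<le> B" for n
        using mix_le[of n] moment_mixture[OF kernel \<sigma>] by simp
    qed
    then obtain r\<^sub>1 \<sigma>\<^sub>0 where r\<^sub>1: "strict_mono r\<^sub>1" and \<sigma>\<^sub>0: "\<sigma>\<^sub>0 \<in> borel_probs"
      and conv_\<sigma>: "narrowly_converges (\<lambda>n. \<sigma> (r\<^sub>1 n)) \<sigma>\<^sub>0"
      using prokhorov_subsequence[of \<sigma>] \<sigma> by blast
    obtain r\<^sub>2 \<Gamma>\<^sub>0 where r\<^sub>2: "strict_mono r\<^sub>2" and \<Gamma>\<^sub>0: "\<Gamma>\<^sub>0 \<in> borel_probs"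
      and conv_\<Gamma>: "narrowly_converges (\<lambda>n. \<Gamma> (r\<^sub>1 (r\<^sub>2 n))) \<Gamma>\<^sub>0"
      using prokhorov_subsequence[of "\<lambda>n. \<Gamma> (r\<^sub>1 n)"] \<Gamma>_prob tight_\<Gamma> by blast
    define r where "r n = r\<^sub>1 (r\<^sub>2 n)" for n
    have r: "strict_mono r"
      using strict_mono_o[OF r\<^sub>1 r\<^sub>2] by (simp add: r_def[abs_def] o_def)
    have conv_\<sigma>': "narrowly_converges (\<lambda>n. \<sigma> (r n)) \<sigma>\<^sub>0"
      unfolding r_def using conv_\<sigma> r\<^sub>2 by (rule narrowly_converges_subseq)
    have conv_\<Gamma>': "narrowly_converges (\<lambda>n. \<Gamma> (r n)) \<Gamma>\<^sub>0"
      unfolding r_def by (rule conv_\<Gamma>)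
    have marginal: "(\<lambda>n. \<integral>y. f y \<partial>distr (\<Gamma> (r n)) borel q) \<longlonglongrightarrow> (\<integral>y. f y \<partial>distr \<Gamma>\<^sub>0 borel q)"
      if q: "continuous_on UNIV q" and f: "f \<in> bounded_continuous"
      for q :: "(real ^ 'd) \<times> (real ^ 'd) \<Rightarrow> real ^ 'd" and f :: "real ^ 'd \<Rightarrow> real"
    proof -
      have fc: "continuous_on UNIV f" "f \<in> borel_measurable borel"
        using f by (auto simp: bounded_continuous_def intro: borel_measurable_continuous_onI)
      \<comment> \<open>Composing with a continuous projection preserves test functions, so
        marginals inherit narrow convergence.\<close>
      have "(\<lambda>z. f (q z)) \<in> bounded_continuous"
        using f q unfolding bounded_continuous_def
        by (auto intro: continuous_on_compose2[OF fc(1)] bounded_subset)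
      then have "(\<lambda>n. \<integral>z. f (q z) \<partial>\<Gamma> (r n)) \<longlonglongrightarrow> (\<integral>z. f (q z) \<partial>\<Gamma>\<^sub>0)"
        using conv_\<Gamma>' by (simp add: narrowly_converges_def)
      then show ?thesis
        using borel_measurable_continuous_borel_probs[OF q] \<Gamma>_prob \<Gamma>\<^sub>0 fc(2) by (simp add: integral_distr)
    qed
    have distr_prob: "distr \<Gamma>\<^sub>0 borel q \<in> borel_probs" if "continuous_on UNIV q"
      for q :: "(real ^ 'd) \<times> (real ^ 'd) \<Rightarrow> real ^ 'd"
      using \<Gamma>\<^sub>0 borel_measurable_continuous_borel_probs[OF that \<Gamma>\<^sub>0]
      by (auto simp: borel_probs_iff intro: prob_space.prob_space_distr)
    have "distr \<Gamma>\<^sub>0 borel snd = \<nu>"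
    proof (rule measure_eqI_bounded_continuous)
      show "\<nu> \<in> borel_probs"
        using \<nu> by (simp add: finite_moment_probs_def)
      fix f :: "real ^ 'd \<Rightarrow> real" assume "f \<in> bounded_continuous"
      then have "(\<lambda>n. \<integral>y. f y \<partial>\<nu>) \<longlonglongrightarrow> (\<integral>y. f y \<partial>distr \<Gamma>\<^sub>0 borel snd)"
        using marginal[of snd f] \<Gamma> by (simp add: couplings_def continuous_on_snd)
      then show "(\<integral>y. f y \<partial>distr \<Gamma>\<^sub>0 borel snd) = (\<integral>y. f y \<partial>\<nu>)"
        using LIMSEQ_unique[OF tendsto_const] by metis
    qed (intro distr_prob continuous_intros)
    \<comment> \<open>The integrals of \<open>f\<close> against the first marginals have two limits:
      one from the couplings, one from \<open>\<sigma> (r n)\<close> tested against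
      \<open>x \<mapsto> \<integral>y. f y \<partial>\<rho> x\<close>, which is bounded and, by
      \<open>CTY\<close>, continuous. Uniqueness of limits identifies them.\<close>
    moreover have "distr \<Gamma>\<^sub>0 borel fst = mixture \<rho> \<sigma>\<^sub>0"
      unfolding mixture_iff[OF kernel \<sigma>\<^sub>0]
    proof (intro conjI ballI)
      show "distr \<Gamma>\<^sub>0 borel fst \<in> borel_probs"
        by (intro distr_prob continuous_intros)
      fix f :: "real ^ 'd \<Rightarrow> real" assume f: "f \<in> bounded_continuous"
      have "(\<integral>y. f y \<partial>distr (\<Gamma> (r n)) borel fst) = (\<integral>x. (\<integral>y. f y \<partial>\<rho> x) \<partial>\<sigma> (r n))" for n
        using \<Gamma>[of "r n"] f mixture_iff[OF kernel \<sigma>, of _ "r n"] by (auto simp: couplings_def)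
      then have "(\<lambda>n. \<integral>x. (\<integral>y. f y \<partial>\<rho> x) \<partial>\<sigma> (r n)) \<longlonglongrightarrow> (\<integral>y. f y \<partial>distr \<Gamma>\<^sub>0 borel fst)"
        using marginal[OF _ f, of fst] by (simp add: continuous_on_fst)
      moreover have "(\<lambda>x. \<integral>y. f y \<partial>\<rho> x) \<in> bounded_continuous"
        unfolding bounded_continuous_def
      proof (intro CollectI conjI)
        show "continuous_on UNIV (\<lambda>x. \<integral>y. f y \<partial>\<rho> x)"
          using CTY f unfolding continuous_map_narrow_topology_iff by simp
        obtain C where C: "\<And>y. \<bar>f y\<bar> \<le> C"
          using f by (auto simp: bounded_continuous_def bounded_iff)
        have "\<bar>\<integral>y. f y \<partial>\<rho> x\<bar> \<le> C" for x
        proof -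
          have \<rho>x: "\<rho> x \<in> borel_probs" using kernel by (simp add: markov_kernel_def)
          then interpret prob_space "\<rho> x" by (simp add: borel_probs_iff)
          have "integrable (\<rho> x) f"
            using C f borel_measurable_continuous_borel_probs[OF _ \<rho>x, of f]
            by (intro integrable_const_bound[of _ C]) (auto simp: bounded_continuous_def)
          then have "(\<integral>y. \<bar>f y\<bar> \<partial>\<rho> x) \<le> C"
            using C by (intro integral_le_const) auto
          then show ?thesis
            using integral_abs_bound[of "\<rho> x" f] by linarith
        qed
        then show "bounded (range (\<lambda>x. \<integral>y. f y \<partial>\<rho> x))"
          unfolding bounded_iff by auto
      qed
      then have "(\<lambda>n. \<integral>x. (\<integral>y. f y \<partial>\<rho> x) \<partial>\<sigma> (r n)) \<longlonglongrightarrow> (\<integral>x. (\<integral>y. f y \<partial>\<rho> x) \<partial>\<sigma>\<^sub>0)"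
        using conv_\<sigma>' by (simp add: narrowly_converges_def)
      ultimately show "(\<integral>y. f y \<partial>distr \<Gamma>\<^sub>0 borel fst) = (\<integral>x. (\<integral>y. f y \<partial>\<rho> x) \<partial>\<sigma>\<^sub>0)"
        by (rule LIMSEQ_unique)
    qed
    ultimately have "\<Gamma>\<^sub>0 \<in> couplings (mixture \<rho> \<sigma>\<^sub>0) \<nu>"
      using \<Gamma>\<^sub>0 by (simp add: couplings_def)
    then have "wasserstein_pow p (mixture \<rho> \<sigma>\<^sub>0) \<nu> \<le> cost \<Gamma>\<^sub>0"
      by (rule W_le)
    \<comment> \<open>Lower semicontinuity of the cost, with the upper bounds \<open>b (r n)\<close>
      tending to \<open>I\<close>.\<close>
    also have "cost \<Gamma>\<^sub>0 \<le> I"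
      unfolding cost_def
    proof (rule nn_integral_le_of_narrowly_converges[OF _ \<Gamma>\<^sub>0 conv_\<Gamma>'])
      show "continuous_on UNIV (\<lambda>z :: (real ^ 'd) \<times> (real ^ 'd). norm (fst z - snd z) powr p)"
        using p by (intro continuous_on_norm_powr continuous_intros) auto
      show "(\<integral>\<^sup>+z. ennreal (norm (fst z - snd z) powr p) \<partial>\<Gamma> (r n)) \<le> b (r n)" for n
        using cost_le by (simp add: cost_def)
      show "(\<lambda>n. b (r n)) \<longlonglongrightarrow> I"
        using LIMSEQ_subseq_LIMSEQ[OF b_lim r] by (simp add: o_def)
    qed (use \<Gamma>_prob in auto)
    finally show ?thesis
      using I_le[OF \<sigma>\<^sub>0] \<sigma>\<^sub>0 unfolding I_def[symmetric] by (intro bexI[of _ \<sigma>\<^sub>0]) (auto intro: antisym)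
  qed
qed

end
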